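(* Let $L$ be a smooth convex body in $\mathbb{R}^n$. Then there exists an $n$-simplex $S\subseteq\mathbb{R}^n$ such that $L_u$ contains a translate of $S_u$ for every unit vector $u\in\mathbb{R}^n$, while $L$ does not contain a translate of $S$.
   Context: A convex body in $\mathbb{R}^n$ here is a compact convex set with nonempty interior; it is smooth if every boundary point $x$ is regular, i.e. the outward normal cone $\{u : u\cdot(y-x)\le0 \text{ for all } y\in L\}$ at $x$ contains exactly one unit vector. For a unit vector $u$, $K_u$ denotes the orthogonal projection of $K$ onto the hyperplane $u^\perp$. An $n$-simplex is the convex hull of $n+1$ affinely independent points. *)

theory Defs
  imports "HOL-Analysis.Analysis"
begin

definition convex_body :: "'a::euclidean_space set \<Rightarrow> bool" where
  "convex_body K \<longleftrightarrow> compact K \<and> convex K \<and> interior K \<noteq> {}"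

definition normal_cone :: "'a::euclidean_space set \<Rightarrow> 'a \<Rightarrow> 'a set" where
  "normal_cone K x = {u. \<forall>y\<in>K. u \<bullet> (y - x) \<le> 0}"

definition smooth_convex_body :: "'a::euclidean_space set \<Rightarrow> bool" where
  "smooth_convex_body K \<longleftrightarrow>
     convex_body K \<and> (\<forall>x\<in>frontier K. \<exists>!u. norm u = 1 \<and> u \<in> normal_cone K x)"

(* Orthogonal projection onto the hyperplane through 0 with normal u.
   The formula is the projection only for norm u = 1. *)
definition hyperplane_proj :: "'a::euclidean_space \<Rightarrow> 'a \<Rightarrow> 'a" where
  "hyperplane_proj u x = x - (x \<bullet> u) *\<^sub>R u"

lemma hyperplane_proj_eq_closest_point:
  fixes u x :: "'a::euclidean_space"
  assumes "norm u = 1"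
  shows "hyperplane_proj u x = closest_point {y. u \<bullet> y = 0} x"
proof -
  have uu: "u \<bullet> u = 1"
    using assms by (simp add: dot_square_norm)
  have "hyperplane_proj u x \<in> {y. u \<bullet> y = 0}"
    by (simp add: hyperplane_proj_def inner_diff_right uu inner_commute)
  moreover have "dist x (hyperplane_proj u x) \<le> dist x z" if "u \<bullet> z = 0" for z
  proof -
    have "dist x (hyperplane_proj u x) = \<bar>(x - z) \<bullet> u\<bar>"
      using that assms
      by (simp add: hyperplane_proj_def dist_norm inner_diff_left inner_diff_right inner_commute)
    also have "\<dots> \<le> dist x z"
      using Cauchy_Schwarz_ineq2[of "x - z" u] assms by (simp add: dist_norm)
    finally show ?thesis .
  qed
  ultimately show ?thesis
    by (intro closest_point_unique convex_hyperplane closed_hyperplane) auto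
qed

definition contains_translate :: "'a::euclidean_space set \<Rightarrow> 'a set \<Rightarrow> bool" where
  "contains_translate K S \<longleftrightarrow> (\<exists>t. (+) t ` S \<subseteq> K)"

end

(* Take the vertices x_i of a simplex of maximal volume inscribed in L. By maximality each
   barycentric coordinate z |-> alpha_i + c_i . z of that simplex is at most 1 on L, so the
   gradient c_i is an outward normal of L at x_i. If (1 + eps) x_i + t lay in L for all i, then
   summing c_i . (eps x_i + t) <= 0 over i would give eps n <= 0, since sum_i c_i = 0 and
   sum_i c_i . x_i = n.

   For the projections, fix a unit vector u. Not all c_i are orthogonal to u; if c_j is not, the
   vector v = sum_i (x_j - x_i) satisfies c_i . v = -1 for all i other than j. Hence
   c_i . (v + r_i u) < 0 for suitable r_i, and by smoothness all x_i + d (v + r_i u) are interior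
   points of L for small d > 0. So S_u has a translate in the relative interior of L_u, which
   leaves room to enlarge S a little; compactness of the sphere makes the factor uniform in u. *)

theory Submission
  imports Defs
begin

section \<open>Inscribed simplices of maximal volume and barycentric coordinates\<close>

text \<open>The extra coordinate 1 turns affine relations into linear ones: the determinant of
  \<open>n + 1\<close> homogenized points is, up to sign, n! times the volume of their simplex. The
  type \<open>'n option\<close> has \<open>n + 1\<close> elements and indexes both vertices and
  coordinates.\<close>

definition homogenize :: "real ^ 'n \<Rightarrow> real ^ ('n option)" where
  "homogenize z = (\<chi> k. case k of None \<Rightarrow> 1 | Some m \<Rightarrow> z $ m)"

lemma sum_UNIV_option:
  fixes f :: "'n::finite option \<Rightarrow> 'b::comm_monoid_add"
  shows "(\<Sum>k\<in>UNIV. f k) = f None + (\<Sum>m\<in>UNIV. f (Some m))"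
  by (simp add: UNIV_option_conv sum.reindex)

lemma compact_vec_of_members:
  fixes L :: "'a::euclidean_space set"
  assumes "compact L"
  shows "compact {x :: 'a ^ 'i. \<forall>i. x $ i \<in> L}"
proof -
  obtain B where B: "\<And>z. z \<in> L \<Longrightarrow> norm z \<le> B"
    using compact_imp_bounded[OF assms] by (auto simp: bounded_iff)
  have "norm x \<le> (\<Sum>i\<in>(UNIV::'i set). B)" if "\<forall>i. x $ i \<in> L" for x :: "'a ^ 'i"
  proof -
    have "norm x \<le> (\<Sum>i\<in>UNIV. norm (x $ i))"
      unfolding norm_vec_def by (rule L2_set_le_sum) simp
    also have "\<dots> \<le> (\<Sum>i\<in>(UNIV::'i set). B)"
      using that B by (intro sum_mono) auto
    finally show ?thesis .
  qed
  then have "bounded {x :: 'a ^ 'i. \<forall>i. x $ i \<in> L}"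
    by (auto simp: bounded_iff)
  moreover have "closed {x :: 'a ^ 'i. x $ i \<in> L}" for i
    using continuous_closed_vimage[of L "\<lambda>x :: 'a ^ 'i. x $ i"] compact_imp_closed[OF assms]
    by (simp add: vimage_def)
  ultimately show ?thesis
    by (simp add: compact_eq_bounded_closed closed_Collect_all)
qed

text \<open>The determinant is a polynomial in the vertices, so its absolute value attains a maximum
  on the compact product of copies of \<open>L\<close>. The maximum is positive because a ball
  inside \<open>L\<close> contains a nondegenerate corner simplex, called \<open>q\<close>
  below.\<close>

lemma exists_max_volume_simplex:
  fixes L :: "(real ^ 'n) set"
  assumes "convex_body L"
  obtains x :: "(real ^ 'n) ^ ('n option)"
  where "\<And>i. x $ i \<in> L" "det (\<chi> i. homogenize (x $ i)) \<noteq> 0"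
    "\<And>y. (\<And>i. y $ i \<in> L) \<Longrightarrow>
      \<bar>det (\<chi> i. homogenize (y $ i))\<bar> \<le> \<bar>det (\<chi> i. homogenize (x $ i))\<bar>"
proof -
  define F where "F = (\<lambda>x :: (real ^ 'n) ^ ('n option). \<bar>det (\<chi> i. homogenize (x $ i))\<bar>)"
  let ?X = "{x :: (real ^ 'n) ^ ('n option). \<forall>i. x $ i \<in> L}"
  have entry: "continuous_on ?X (\<lambda>x. homogenize (x $ i) $ k)" for i k
    by (cases k) (auto simp: homogenize_def intro!: continuous_intros)
  have cont: "continuous_on ?X F"
    unfolding F_def det_def vec_lambda_beta
    by (rule continuous_on_rabs continuous_on_sum continuous_on_mult continuous_on_const
        continuous_on_prod entry)+
  obtain p r where r: "r > 0" and pr: "cball p r \<subseteq> L"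
    using assms by (auto simp: convex_body_def mem_interior_cball)
  define q :: "(real ^ 'n) ^ ('n option)"
    where "q = (\<chi> i. case i of None \<Rightarrow> p | Some m \<Rightarrow> p + r *\<^sub>R axis m 1)"
  have qX: "q \<in> ?X"
  proof (clarify)
    fix i show "q $ i \<in> L"
      using r pr by (cases i) (auto simp: q_def subset_iff dist_norm norm_axis_1)
  qed
  \<comment> \<open>Subtracting row \<open>None\<close> from row \<open>Some j\<close> leaves
    \<open>r\<close> times the \<open>Some j\<close> entry of \<open>w\<close>, so the kernel is
    trivial.\<close>
  have "w = 0" if w: "(\<chi> i. homogenize (q $ i)) *v w = 0" for w
  proof -
    have row: "(\<Sum>k\<in>UNIV. homogenize (q $ i) $ k * w $ k) = 0" for i
      using w by (simp add: vec_eq_iff matrix_vector_mult_def)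
    have N: "w $ None + (\<Sum>m\<in>UNIV. p $ m * w $ Some m) = 0"
      using row[of None] by (simp add: sum_UNIV_option homogenize_def q_def)
    have S: "w $ Some j = 0" for j
    proof -
      have "w $ None + (\<Sum>m\<in>UNIV. (p $ m + r * axis j 1 $ m) * w $ Some m) = 0"
        using row[of "Some j"] by (simp add: sum_UNIV_option homogenize_def q_def)
      then have "(\<Sum>m\<in>UNIV. r * axis j 1 $ m * w $ Some m) = 0"
        using N by (simp add: distrib_right sum.distrib)
      moreover have "(\<Sum>m\<in>UNIV. r * axis j 1 $ m * w $ Some m)
          = (\<Sum>m\<in>UNIV. if m = j then r * w $ Some m else 0)"
        by (rule sum.cong) (auto simp: axis_def)
      ultimately show ?thesis
        using r by simp
    qed
    have "w $ k = 0" for k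
      using N S by (cases k) simp_all
    then show ?thesis
      by (simp add: vec_eq_iff)
  qed
  then have "invertible (\<chi> i. homogenize (q $ i))"
    using matrix_left_invertible_ker invertible_left_inverse by blast
  then have "F q > 0"
    by (simp add: F_def invertible_det_nz)
  obtain x where x: "x \<in> ?X" and max: "\<And>y. y \<in> ?X \<Longrightarrow> F y \<le> F x"
    using continuous_attains_sup[OF compact_vec_of_members _ cont] qX assms
    by (auto simp: convex_body_def)
  have "F x > 0"
    using max[OF qX] \<open>F q > 0\<close> by simp
  then show thesis
    using that[of x] x max by (simp add: F_def)
qed

text \<open>The inverse of the matrix of homogenized vertices yields the barycentric coordinates,
  with constant terms \<alpha> and gradients \<open>c\<close>. By Cramer's rule, replacing vertex
  \<open>k\<close> by \<open>z\<close> multiplies the determinant by the \<open>k\<close>-th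
  coordinate of \<open>z\<close>, so maximality bounds that coordinate by 1 on
  \<open>L\<close>.\<close>

lemma exists_barycentric_frame:
  fixes L :: "(real ^ 'n) set"
  assumes "convex_body L"
  obtains x :: "'n option \<Rightarrow> real ^ 'n" and \<alpha> :: "'n option \<Rightarrow> real"
    and c :: "'n option \<Rightarrow> real ^ 'n"
  where "\<And>i. x i \<in> L"
    "\<And>k z. z \<in> L \<Longrightarrow> \<alpha> k + c k \<bullet> z \<le> 1"
    "\<And>k j. \<alpha> k + c k \<bullet> x j = (if k = j then 1 else 0)"
    "\<And>z. (\<Sum>k\<in>UNIV. \<alpha> k + c k \<bullet> z) = 1"
    "\<And>z. (\<Sum>k\<in>UNIV. (\<alpha> k + c k \<bullet> z) *\<^sub>R x k) = z"
proof -
  obtain x :: "(real ^ 'n) ^ ('n option)" where xL: "\<And>i. x $ i \<in> L"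
    and nz: "det (\<chi> i. homogenize (x $ i)) \<noteq> 0"
    and max: "\<And>y. (\<And>i. y $ i \<in> L) \<Longrightarrow>
      \<bar>det (\<chi> i. homogenize (y $ i))\<bar> \<le> \<bar>det (\<chi> i. homogenize (x $ i))\<bar>"
    by (rule exists_max_volume_simplex[OF assms]) blast
  define A where "A = (\<chi> i. homogenize (x $ i))"
  obtain B where AB: "A ** B = mat 1" and BA: "B ** A = mat 1"
    using nz by (metis A_def invertible_def invertible_det_nz)
  define l where "l = (\<lambda>z. homogenize z v* B)"
  have lA: "l z v* A = homogenize z" for z
    by (simp add: l_def vector_matrix_mul_assoc BA)
  define \<alpha> where "\<alpha> k = B $ None $ k" for k
  define c :: "'n option \<Rightarrow> real ^ 'n" where "c k = (\<chi> m. B $ Some m $ k)" for k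
  have l: "l z $ k = \<alpha> k + c k \<bullet> z" for z k
    by (simp add: l_def vector_matrix_mult_def sum_UNIV_option homogenize_def \<alpha>_def c_def
        inner_vec_def mult.commute)
  \<comment> \<open>Component \<open>None\<close> says that the coordinates sum to 1; the components
    \<open>Some m\<close> recover \<open>z\<close> from the vertices.\<close>
  have comp: "(\<Sum>i\<in>UNIV. l z $ i * homogenize (x $ i) $ k) = homogenize z $ k" for z k
    using arg_cong[OF lA[of z], of "\<lambda>v. v $ k"]
    by (simp add: vector_matrix_mult_def A_def mult.commute)
  show thesis
  proof (rule that[of "\<lambda>i. x $ i" \<alpha> c])
    show "x $ i \<in> L" for i by (rule xL)
    show "(\<Sum>k\<in>UNIV. \<alpha> k + c k \<bullet> z) = 1" for z
      using comp[of z None] by (simp add: homogenize_def l)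
    show "(\<Sum>k\<in>UNIV. (\<alpha> k + c k \<bullet> z) *\<^sub>R x $ k) = z" for z
      using comp[of z "Some m" for m] by (simp add: homogenize_def l vec_eq_iff)
    show "\<alpha> k + c k \<bullet> x $ j = (if k = j then 1 else 0)" for k j
    proof -
      have "l (x $ j) $ k = (A ** B) $ j $ k"
        by (simp add: l_def vector_matrix_mult_def matrix_matrix_mult_def A_def mult.commute)
      then show ?thesis
        by (simp add: AB l mat_def eq_commute)
    qed
    show "\<alpha> k + c k \<bullet> z \<le> 1" if z: "z \<in> L" for k z
    proof -
      define y where "y = (\<chi> i. if i = k then z else x $ i)"
      have hz: "homogenize z = (\<Sum>i\<in>UNIV. l z $ i *s row i A)"
        using comp[of z] by (simp add: vec_eq_iff row_def A_def)
      have "(\<chi> i. homogenize (y $ i)) = (\<chi> i. if i = k then homogenize z else row i A)"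
        by (auto simp: vec_eq_iff y_def row_def A_def)
      then have "det (\<chi> i. homogenize (y $ i)) = l z $ k * det A"
        unfolding hz by (simp only: cramer_lemma_transpose)
      moreover have "\<bar>det (\<chi> i. homogenize (y $ i))\<bar> \<le> \<bar>det A\<bar>"
        unfolding A_def using xL z by (intro max) (auto simp: y_def)
      ultimately have "\<bar>l z $ k\<bar> * \<bar>det A\<bar> \<le> 1 * \<bar>det A\<bar>"
        by (simp add: abs_mult)
      then have "\<bar>l z $ k\<bar> \<le> 1"
        using nz by (subst (asm) mult_le_cancel_right) (auto simp: A_def)
      then show ?thesis
        by (simp add: l)
    qed
  qed
qed

section \<open>Inward directions at a regular boundary point\<close>

text \<open>If the open ray from \<open>x\<close> along \<open>w\<close> missed the interior, a
  separating hyperplane would support \<open>L\<close> at \<open>x\<close>, with a normal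
  \<open>a\<close> satisfying \<open>a \<bullet> w \<ge> 0\<close>. Smoothness makes
  \<open>a\<close> a positive multiple of \<open>c\<close>, against
  \<open>c \<bullet> w < 0\<close>. Once one point of the ray is interior, convexity covers all
  points between it and \<open>x\<close>.\<close>

lemma smooth_convex_body_inward_interior:
  fixes L :: "'a::euclidean_space set"
  assumes L: "smooth_convex_body L" and x: "x \<in> L"
    and c: "c \<in> normal_cone L x" and w: "c \<bullet> w < 0"
  obtains d where "d > 0" "\<And>e. 0 < e \<Longrightarrow> e \<le> d \<Longrightarrow> x + e *\<^sub>R w \<in> interior L"
proof -
  have cvx: "convex L" and ne: "interior L \<noteq> {}" and cl: "closed L"
    using L by (auto simp: smooth_convex_body_def convex_body_def compact_imp_closed)
  have c0: "c \<noteq> 0" using w by auto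
  have clint: "closure (interior L) = L"
    using convex_closure_interior[OF cvx ne] cl by simp
  have "\<exists>d>0. x + d *\<^sub>R w \<in> interior L"
  proof (rule ccontr)
    assume no: "\<not> ?thesis"
    define R where "R = (\<lambda>d. x + d *\<^sub>R w) ` {0<..}"
    have "R = (+) x ` (\<lambda>d. d *\<^sub>R w) ` {0<..}"
      by (simp add: R_def image_image)
    moreover have "convex ((+) x ` (\<lambda>d. d *\<^sub>R w) ` {0<..})"
      by (intro convex_translation convex_linear_image)
        (simp_all add: bounded_linear.linear[OF bounded_linear_scaleR_left])
    ultimately have "convex R" by simp
    moreover have "R \<inter> interior L = {}" "R \<noteq> {}"
      using no by (auto simp: R_def)
    ultimately obtain a b where a: "a \<noteq> 0"
      and aL: "\<And>y. y \<in> interior L \<Longrightarrow> a \<bullet> y \<le> b" and aR: "\<And>y. y \<in> R \<Longrightarrow> a \<bullet> y \<ge> b"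
      using separating_hyperplane_sets[of "interior L" R] convex_interior[OF cvx] ne by blast
    have aL': "a \<bullet> y \<le> b" if "y \<in> L" for y
    proof -
      have "closure (interior L) \<subseteq> {y. a \<bullet> y \<le> b}"
        by (rule closure_minimal) (auto simp: aL closed_halfspace_le)
      then show ?thesis using that clint by auto
    qed
    have ray: "a \<bullet> x + d * (a \<bullet> w) \<ge> b" if "d > 0" for d
      using aR[of "x + d *\<^sub>R w"] that by (auto simp: R_def inner_add_right)
    have aw: "a \<bullet> w \<ge> 0"
      using ray[of 1] aL'[OF x] by simp
    \<comment> \<open>This is the ray inequality in the limit \<open>d\<close> to 0. The 1 in the
      denominator of \<open>d\<close> covers the case \<open>a \<bullet> w = 0\<close>.\<close>
    have ax: "a \<bullet> x \<ge> b"
    proof (rule field_le_epsilon)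
      fix e :: real assume "e > 0"
      define d where "d = e / (a \<bullet> w + 1)"
      have "d > 0" using \<open>e > 0\<close> aw by (simp add: d_def)
      moreover have "d * (a \<bullet> w) \<le> e"
        using \<open>e > 0\<close> aw by (simp add: d_def field_simps)
      ultimately show "b \<le> a \<bullet> x + e"
        using ray[of d] by linarith
    qed
    have acone: "a \<in> normal_cone L x"
      using aL' ax by (fastforce simp: normal_cone_def inner_diff_right)
    have scale: "sgn v \<in> normal_cone L x" if "v \<in> normal_cone L x" for v
      using that by (auto simp: normal_cone_def sgn_div_norm mult_nonneg_nonpos)
    \<comment> \<open>Uniqueness of the unit normal is given on the frontier only. At an interior
      point a small move along \<open>c\<close> would stay in \<open>L\<close> and increase the
      product with \<open>c\<close>.\<close>
    have "x \<notin> interior L"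
    proof
      assume "x \<in> interior L"
      then obtain r where r: "r > 0" "cball x r \<subseteq> L"
        by (auto simp: mem_interior_cball)
      then have "x + r *\<^sub>R sgn c \<in> L"
        using c0 by (auto simp: subset_iff dist_norm norm_sgn)
      then have "c \<bullet> (r *\<^sub>R sgn c) \<le> 0"
        using c by (fastforce simp: normal_cone_def)
      moreover have "c \<bullet> (r *\<^sub>R sgn c) > 0"
        using r c0 by (simp add: sgn_div_norm)
      ultimately show False by simp
    qed
    then have "x \<in> frontier L"
      using x cl by (simp add: frontier_def)
    then have "\<exists>!u. norm u = 1 \<and> u \<in> normal_cone L x"
      using L by (simp add: smooth_convex_body_def)
    then have "sgn a = sgn c"
      using scale[OF acone] scale[OF c] a c0 by (metis norm_sgn)
    moreover have "sgn a \<bullet> w \<ge> 0"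
      using aw by (simp add: sgn_div_norm)
    moreover have "sgn c \<bullet> w < 0"
      using w c0 by (simp add: sgn_div_norm mult_pos_neg)
    ultimately show False by simp
  qed
  then obtain d where d: "d > 0" "x + d *\<^sub>R w \<in> interior L" by blast
  show thesis
  proof (rule that[OF d(1)])
    fix e assume e: "0 < e" "e \<le> d"
    have "x - (e / d) *\<^sub>R (x - (x + d *\<^sub>R w)) \<in> interior L"
      using e d x by (intro mem_interior_convex_shrink[OF cvx d(2)]) auto
    then show "x + e *\<^sub>R w \<in> interior L"
      using d(1) by simp
  qed
qed

section \<open>Projections of hulls and uniformity over a compact set\<close>

lemma hyperplane_proj_linear: "linear (hyperplane_proj u)"
  by (rule linearI) (simp_all add: hyperplane_proj_def algebra_simps)

text \<open>The projection forgets multiples of \<open>u\<close>, so each vertex may have its own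
  shift \<open>s\<close> along \<open>u\<close>; only \<open>t\<close> must be common. Convexity of
  the projected body passes from the vertices to their hull.\<close>

lemma contains_translate_hyperplane_projI:
  fixes L :: "'a::euclidean_space set"
  assumes "norm u = 1" "convex L" and L: "\<And>v. v \<in> V \<Longrightarrow> \<exists>s. v + t + s *\<^sub>R u \<in> L"
  shows "contains_translate (hyperplane_proj u ` L) (hyperplane_proj u ` (convex hull V))"
proof -
  let ?p = "hyperplane_proj u"
  have uu: "u \<bullet> u = 1"
    using assms by (simp add: dot_square_norm)
  have "?p t + ?p v \<in> ?p ` L" if v: "v \<in> V" for v
  proof -
    obtain s where s: "v + t + s *\<^sub>R u \<in> L" using L[OF v] by blast
    have "?p t + ?p v = ?p (v + t + s *\<^sub>R u)"
      by (simp add: hyperplane_proj_def algebra_simps uu)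
    then show ?thesis using s by blast
  qed
  then have "(+) (?p t) ` ?p ` V \<subseteq> ?p ` L"
    by auto
  moreover have "convex (?p ` L)"
    by (rule convex_linear_image[OF hyperplane_proj_linear assms(2)])
  ultimately have "convex hull ((+) (?p t) ` ?p ` V) \<subseteq> ?p ` L"
    by (rule hull_minimal)
  then have "(+) (?p t) ` ?p ` (convex hull V) \<subseteq> ?p ` L"
    by (simp add: convex_hull_translation convex_hull_linear_image[OF hyperplane_proj_linear])
  then show ?thesis
    by (auto simp: contains_translate_def)
qed

text \<open>Finitely many of the balls on which all small \<open>e\<close> work cover
  \<open>K\<close>, and any positive \<open>e\<close> below all their radii works
  everywhere.\<close>

lemma eventually_uniform_on_compact:
  fixes K :: "'a::metric_space set"
  assumes "compact K"
    and loc: "\<And>u. u \<in> K \<Longrightarrow> \<exists>d>0. \<forall>v e. dist v u < d \<longrightarrow> 0 < e \<longrightarrow> e < d \<longrightarrow> P v e"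
  shows "\<exists>e>0::real. \<forall>u\<in>K. P u e"
proof -
  obtain d where d: "\<And>u. u \<in> K \<Longrightarrow> d u > 0"
    and P: "\<And>u v e. u \<in> K \<Longrightarrow> dist v u < d u \<Longrightarrow> 0 < e \<Longrightarrow> e < d u \<Longrightarrow> P v e"
    using loc by metis
  have "K \<subseteq> (\<Union>u\<in>K. ball u (d u))"
    using d by force
  then obtain C where C: "C \<subseteq> K" "finite C" "K \<subseteq> (\<Union>u\<in>C. ball u (d u))"
    using compactE_image[OF assms(1), of K "\<lambda>u. ball u (d u)"] by auto
  \<comment> \<open>The inserted 1 keeps \<open>Min\<close> meaningful when the subcover is empty;
    halving \<open>m\<close> later gives the strict inequality.\<close>
  define m where "m = Min (insert 1 (d ` C))"
  have m: "m > 0" "\<And>u. u \<in> C \<Longrightarrow> m \<le> d u"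
    using C d by (auto simp: m_def)
  have "m / 2 > 0"
    using m by simp
  moreover have "P v (m / 2)" if "v \<in> K" for v
  proof -
    have "v \<in> (\<Union>u\<in>C. ball u (d u))"
      using C(3) that by blast
    then obtain u where u: "u \<in> C" "dist v u < d u"
      by (auto simp: dist_commute)
    then show ?thesis
      using P[of u v "m / 2"] C(1) m(1) m(2)[OF u(1)] by auto
  qed
  ultimately show ?thesis by blast
qed

section \<open>The enlarged maximal simplex\<close>

theorem corollary4p6:
  fixes L :: "(real ^ 'n) set"
  assumes "smooth_convex_body L"
  shows "\<exists>S :: (real ^ 'n) set. int CARD('n) simplex S
           \<and> (\<forall>u. norm u = 1 \<longrightarrow>
                contains_translate (hyperplane_proj u ` L) (hyperplane_proj u ` S))
           \<and> \<not> contains_translate L S"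
proof -
  have body: "convex_body L" and cvx: "convex L"
    using assms by (auto simp: smooth_convex_body_def convex_body_def)
  obtain x :: "'n option \<Rightarrow> real ^ 'n" and \<alpha> c where xL: "\<And>i. x i \<in> L"
    and le1: "\<And>k z. z \<in> L \<Longrightarrow> \<alpha> k + c k \<bullet> z \<le> 1"
    and delta: "\<And>k j. \<alpha> k + c k \<bullet> x j = (if k = j then 1 else 0)"
    and sum1: "\<And>z. (\<Sum>k\<in>UNIV. \<alpha> k + c k \<bullet> z) = 1"
    and repr: "\<And>z. (\<Sum>k\<in>UNIV. (\<alpha> k + c k \<bullet> z) *\<^sub>R x k) = z"
    by (rule exists_barycentric_frame[OF body]) blast
  have cdelta: "c k \<bullet> x j = (if k = j then 1 else 0) - \<alpha> k" for k j
    using delta[of k j] by linarith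
  have normal: "c k \<in> normal_cone L (x k)" for k
    using le1[of _ k] delta[of k k] by (fastforce simp: normal_cone_def inner_diff_right)
  have sum\<alpha>: "(\<Sum>k\<in>UNIV. \<alpha> k) = 1"
    using sum1[of 0] by simp
  have sumc: "(\<Sum>k\<in>UNIV. c k \<bullet> z) = 0" for z
    using sum1[of z] sum\<alpha> by (simp add: sum.distrib)
  have sumcx: "(\<Sum>k\<in>UNIV. c k \<bullet> x k) = real CARD('n)"
    by (simp add: cdelta sum_subtractf sum\<alpha>)

  have interior: "\<exists>t s. \<forall>i. x i + t + s i *\<^sub>R u \<in> interior L" if u: "norm u = 1" for u
  proof -
    \<comment> \<open>Otherwise \<open>u\<close> and 0 would have the same barycentric coordinates
      and hence coincide.\<close>
    have "\<exists>j. c j \<bullet> u \<noteq> 0"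
    proof (rule ccontr)
      assume "\<not> ?thesis"
      then have "u = 0"
        using repr[of u] repr[of 0] by simp
      then show False using u by simp
    qed
    then obtain j where j: "c j \<bullet> u \<noteq> 0" by blast
    define v where "v = (\<Sum>i\<in>UNIV. x j - x i)"
    \<comment> \<open>For \<open>k \<noteq> j\<close> only the summand \<open>i = k\<close>
      contributes, since \<open>c k\<close> takes the same value at all vertices other than
      \<open>x k\<close>.\<close>
    have cv: "c k \<bullet> v = -1" if "k \<noteq> j" for k
      using that by (simp add: v_def inner_sum_right inner_diff_right cdelta sum_negf)
    have "\<exists>r. c k \<bullet> (v + r *\<^sub>R u) < 0" for k
    proof (cases "c k \<bullet> u = 0")
      case True
      then have "k \<noteq> j" using j by auto
      then show ?thesis using cv by (intro exI[of _ 0]) simp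
    next
      case False
      \<comment> \<open>The witness makes the inner product equal to -1.\<close>
      then show ?thesis
        by (intro exI[of _ "- (c k \<bullet> v + 1) / (c k \<bullet> u)"]) (simp add: inner_add_right)
    qed
    then obtain r where r: "\<And>k. c k \<bullet> (v + r k *\<^sub>R u) < 0" by metis
    have "\<exists>d>0. \<forall>e. 0 < e \<longrightarrow> e \<le> d \<longrightarrow> x k + e *\<^sub>R (v + r k *\<^sub>R u) \<in> interior L" for k
      using smooth_convex_body_inward_interior[OF assms xL normal r] by metis
    then obtain d where d: "\<And>k. d k > 0"
      "\<And>k e. 0 < e \<Longrightarrow> e \<le> d k \<Longrightarrow> x k + e *\<^sub>R (v + r k *\<^sub>R u) \<in> interior L"
      by metis
    define e where "e = Min (range d)"
    have "e > 0" "\<And>k. e \<le> d k"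
      using d(1) by (auto simp: e_def)
    then have "x k + e *\<^sub>R v + (e * r k) *\<^sub>R u \<in> interior L" for k
      using d(2)[of e k] by (simp add: algebra_simps)
    then show ?thesis
      by (intro exI[of _ "e *\<^sub>R v"] exI[of _ "\<lambda>k. e * r k"]) simp
  qed

  have "\<exists>e>0. \<forall>u\<in>sphere (0 :: real ^ 'n) 1. \<exists>t s. \<forall>i. (1 + e) *\<^sub>R x i + t + s i *\<^sub>R u \<in> L"
  proof (rule eventually_uniform_on_compact)
    fix u :: "real ^ 'n" assume "u \<in> sphere 0 1"
    then obtain t s where ts: "\<And>i. x i + t + s i *\<^sub>R u \<in> interior L"
      using interior[of u] by auto
    \<comment> \<open>With \<open>t\<close> and \<open>s\<close> kept fixed, the points depend
      continuously on the direction and the enlargement. At \<open>(u, 0)\<close> they are interior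
      to \<open>L\<close>, so they stay interior for all nearby pairs.\<close>
    have "\<forall>\<^sub>F p in nhds (u, 0::real). \<forall>i\<in>UNIV. (1 + snd p) *\<^sub>R x i + t + s i *\<^sub>R fst p \<in> interior L"
    proof (intro eventually_ball_finite ballI)
      fix i
      have "((\<lambda>p. (1 + snd p) *\<^sub>R x i + t + s i *\<^sub>R fst p) \<longlongrightarrow>
          (1 + snd (u, 0::real)) *\<^sub>R x i + t + s i *\<^sub>R fst (u, 0::real)) (nhds (u, 0))"
        by (intro tendsto_intros) (auto simp: filterlim_ident)
      then show "\<forall>\<^sub>F p in nhds (u, 0::real). (1 + snd p) *\<^sub>R x i + t + s i *\<^sub>R fst p \<in> interior L"
        using ts[of i] by (auto elim!: topological_tendstoD)
    qed simp
    then obtain d where d: "d > 0"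
      "\<And>p i. dist p (u, 0) < d \<Longrightarrow> (1 + snd p) *\<^sub>R x i + t + s i *\<^sub>R fst p \<in> interior L"
      by (auto simp: eventually_nhds_metric)
    have "(1 + e) *\<^sub>R x i + t + s i *\<^sub>R v \<in> L"
      if "dist v u < d / 2" "0 < e" "e < d / 2" for v e i
    proof -
      have "dist (v, e) (u, 0) \<le> dist v u + \<bar>e\<bar>"
        using sqrt_sum_squares_le_sum_abs[of "dist v u" "dist e 0"] by (simp add: dist_Pair_Pair)
      then show ?thesis
        using d(2)[of "(v, e)" i] that interior_subset by fastforce
    qed
    then show "\<exists>d>0. \<forall>v e. dist v u < d \<longrightarrow> 0 < e \<longrightarrow> e < d \<longrightarrow>
        (\<exists>t s. \<forall>i. (1 + e) *\<^sub>R x i + t + s i *\<^sub>R v \<in> L)"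
      using d(1) by (intro exI[of _ "d / 2"] conjI allI impI exI[of _ t] exI[of _ s]) simp_all
  qed simp
  then obtain e where e: "e > 0"
    and fit: "\<And>u. norm u = 1 \<Longrightarrow> \<exists>t s. \<forall>i. (1 + e) *\<^sub>R x i + t + s i *\<^sub>R u \<in> L"
    by auto

  define y where "y i = (1 + e) *\<^sub>R x i" for i
  have inj: "inj y"
  proof (rule injI)
    fix i j assume "y i = y j"
    then have "x i = x j" using e by (simp add: y_def)
    then show "i = j" using delta[of i i] delta[of i j] by (metis zero_neq_one)
  qed
  have "\<not> affine_dependent (range y)"
  proof
    assume "affine_dependent (range y)"
    then obtain U where U: "sum U (range y) = 0" "\<exists>v\<in>range y. U v \<noteq> 0"
      "(\<Sum>v\<in>range y. U v *\<^sub>R v) = 0"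
      by (auto simp: affine_dependent_explicit_finite)
    have U0: "(\<Sum>i\<in>UNIV. U (y i)) = 0"
      using U(1) by (simp add: sum.reindex[OF inj])
    have "(\<Sum>i\<in>UNIV. U (y i) *\<^sub>R y i) = 0"
      using U(3) by (simp add: sum.reindex[OF inj])
    then have "(1 + e) *\<^sub>R (\<Sum>i\<in>UNIV. U (y i) *\<^sub>R x i) = 0"
      by (simp add: y_def scaleR_sum_right mult.commute)
    then have Ux: "(\<Sum>i\<in>UNIV. U (y i) *\<^sub>R x i) = 0"
      using e by simp
    \<comment> \<open>Pairing the relation with \<open>c k\<close> isolates the coefficient at
      \<open>k\<close>, because the \<alpha> terms cancel when the coefficients sum to 0.\<close>
    have "U (y k) = 0" for k
    proof -
      have "0 = c k \<bullet> (\<Sum>i\<in>UNIV. U (y i) *\<^sub>R x i)"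
        by (simp add: Ux)
      also have "\<dots> = (\<Sum>i\<in>UNIV. (if k = i then U (y i) else 0) - U (y i) * \<alpha> k)"
        by (auto simp: inner_sum_right cdelta algebra_simps intro!: sum.cong)
      also have "\<dots> = U (y k) - (\<Sum>i\<in>UNIV. U (y i)) * \<alpha> k"
        by (simp add: sum_subtractf sum_distrib_right)
      finally show ?thesis by (simp add: U0)
    qed
    then show False using U(2) by auto
  qed
  moreover have "card (range y) = CARD('n) + 1"
    using inj by (simp add: card_image)
  ultimately have "int CARD('n) simplex (convex hull range y)"
    unfolding simplex_def by (intro exI[of _ "range y"]) simp
  moreover have "contains_translate (hyperplane_proj u ` L) (hyperplane_proj u ` (convex hull range y))"
    if u: "norm u = 1" for u
  proof -
    obtain t s where "\<And>i. (1 + e) *\<^sub>R x i + t + s i *\<^sub>R u \<in> L"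
      using fit[OF u] by blast
    then show ?thesis
      by (intro contains_translate_hyperplane_projI[OF u cvx, where t = t]) (auto simp: y_def)
  qed
  moreover have "\<not> contains_translate L (convex hull range y)"
  proof
    assume "contains_translate L (convex hull range y)"
    then obtain t where t: "(+) t ` (convex hull range y) \<subseteq> L"
      by (auto simp: contains_translate_def)
    \<comment> \<open>The \<open>k\<close>-th barycentric coordinate is 1 at \<open>x k\<close> and
      at most 1 at \<open>t + y k\<close>; this is the difference. Summed over \<open>k\<close>, the
      terms in \<open>t\<close> vanish and \<open>e\<close> times the dimension remains.\<close>
    have "e * (c k \<bullet> x k) + c k \<bullet> t \<le> 0" for k
    proof -
      have "t + y k \<in> L"
        using t hull_inc[of "y k" "range y"] by auto
      then show ?thesis
        using le1[of "t + y k" k] delta[of k k] by (simp add: y_def inner_add_right distrib_right)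
    qed
    then have "(\<Sum>k\<in>UNIV. e * (c k \<bullet> x k) + c k \<bullet> t) \<le> 0"
      by (intro sum_nonpos) auto
    then have "e * real CARD('n) \<le> 0"
      by (simp add: sum.distrib sumc sumcx flip: sum_distrib_left)
    then show False
      using e by (simp add: mult_le_0_iff)
  qed
  ultimately show ?thesis by blast
qed

end
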